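(* Let $\mathbb{F}$ be a field and $0\le k\le d-1$ integers. Every set $\mathcal{H}$ of projective $k$-subspaces of $\mathrm{PG}(d,\mathbb{F})$ which is a generator set with respect to co-$k$-subspaces has at least $$\min\left\{|\mathbb{F}|,\ \sum_{i=0}^{k}\left\lfloor\tfrac{d-k+i}{i+1}\right\rfloor\right\}+1$$ elements (where the minimum is the sum if $\mathbb{F}$ is infinite).
   Context: $\mathrm{PG}(d,\mathbb{F})$ is the projective space of $1$-dimensional linear subspaces of $\mathbb{F}^{d+1}$; a projective $j$-subspace corresponds to a linear subspace of rank $j+1$; co-dimension $c$ means projective dimension $d-c$. A set $\mathcal{H}$ of projective $k$-subspaces is a generator set with respect to co-$k$-subspaces (higgledy-piggledy) if for every projective subspace $\Pi$ of co-dimension $k$, the points of $\Pi$ lying in some element of $\mathcal{H}$ span $\Pi$ (are not contained in a hyperplane of $\Pi$). *)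

theory Defs
  imports "HOL-Analysis.Cartesian_Space"
begin

text \<open>
  \<open>PG(d, F)\<close> is modelled on the coordinate space \<open>'a ^ 'n\<close> with \<open>CARD('n) = d + 1\<close>.
  Projective subspaces are identified with the linear subspaces they correspond to, so that
  the incidence of a point (a linear subspace of rank 1) with a projective subspace is inclusion.
\<close>

definition proj_subspace :: "nat \<Rightarrow> ('a::field ^ 'n) set \<Rightarrow> bool" where
  "proj_subspace j U \<longleftrightarrow> vec.subspace U \<and> vec.dim U = j + 1"

abbreviation proj_point :: "('a::field ^ 'n) set \<Rightarrow> bool" where
  "proj_point P \<equiv> proj_subspace 0 P"

text \<open>
  The projective dimension of the ambient space is \<open>CARD('n) - 1\<close>; adding instead of subtracting
  avoids truncation.
\<close>

definition proj_cosubspace :: "nat \<Rightarrow> ('a::field ^ 'n) set \<Rightarrow> bool" where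
  "proj_cosubspace c U \<longleftrightarrow> (\<exists>j. j + c + 1 = CARD('n) \<and> proj_subspace j U)"

text \<open>The projective span of a set of points is the linear span of their union.\<close>

definition proj_span :: "('a::field ^ 'n) set set \<Rightarrow> ('a ^ 'n) set" where
  "proj_span S = vec.span (\<Union> S)"

definition generator_set :: "nat \<Rightarrow> ('a::field ^ 'n) set set \<Rightarrow> bool" where
  "generator_set k \<H> \<longleftrightarrow>
     (\<forall>U. proj_cosubspace k U \<longrightarrow>
        proj_span {P. proj_point P \<and> P \<subseteq> U \<and> (\<exists>H\<in>\<H>. P \<subseteq> H)} = U)"

end

theory Submission
  imports Defs
begin

text \<open>
  Write \<open>r = k + 1\<close> and \<open>n = d - k\<close>. A family of \<open>\<Sum>i<r. \<lfloor>(n + i) / (i + 1)\<rfloor>\<close> subspaces of rank \<open>r\<close>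
  in a space of rank \<open>n + r\<close> always has a transversal of rank \<open>n\<close>: put \<open>\<lfloor>(n + r - 1) / r\<rfloor>\<close> of them
  into a common hyperplane \<open>\<Sigma>\<close>, and treat the intersections of the others with \<open>\<Sigma>\<close>, which have rank
  at least \<open>r - 1\<close>, by induction. The transversal found inside \<open>\<Sigma>\<close> meets the members contained in
  \<open>\<Sigma>\<close> by counting dimensions.

  A generator set \<open>\<H>\<close> with \<open>|\<H>| \<le> |F|\<close> has no such transversal \<open>W\<close>. The sums \<open>H + W\<close> would be at
  most \<open>|F|\<close> proper subspaces, hence would miss some vector \<open>v\<close>. Then every \<open>H \<in> \<H>\<close> would meet
  \<open>\<langle>W, v\<rangle>\<close> only inside its hyperplane \<open>W\<close>.
\<close>

text \<open>Induction on the family. If a vector \<open>v\<close> avoiding all the other members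
  lies in the new one, it is replaced by some \<open>w + c v\<close> with \<open>w\<close> outside
  the new member. Each old member excludes at most one scalar \<open>c\<close>, so fewer than
  \<open>|F|\<close> scalars are lost.\<close>

lemma (in vector_space) subspace_not_covered:
  assumes "finite \<S>" "subspace V"
    and "\<And>S. S \<in> \<S> \<Longrightarrow> subspace S" "\<And>S. S \<in> \<S> \<Longrightarrow> \<not> V \<subseteq> S"
    and "infinite (UNIV :: 'a set) \<or> card \<S> \<le> card (UNIV :: 'a set)"
  shows "\<exists>v\<in>V. \<forall>S\<in>\<S>. v \<notin> S"
  using assms
proof (induction \<S> rule: finite_induct)
  case empty
  then show ?case using subspace_0 by auto
next
  case (insert S0 \<S>)
  have "infinite (UNIV :: 'a set) \<or> card \<S> \<le> card (UNIV :: 'a set)"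
    using insert by auto
  then obtain v where v: "v \<in> V" "\<forall>S\<in>\<S>. v \<notin> S"
    using insert by auto
  obtain w where w: "w \<in> V" "w \<notin> S0"
    using insert.prems(3)[of S0] by auto
  show ?case
  proof (cases "v \<in> S0")
    case False
    with v show ?thesis by auto
  next
    case True
    \<comment> \<open>On the line \<open>w + c v\<close>, which avoids \<open>S0\<close>, every other member has at most one point.\<close>
    define bad where "bad S = {c. w + scale c v \<in> S}" for S
    have bad_unique: "a = b" if "S \<in> \<S>" "a \<in> bad S" "b \<in> bad S" for S a b
    proof (rule ccontr)
      assume "a \<noteq> b"
      have S: "subspace S" using insert that by auto
      have "(w + scale a v) - (w + scale b v) \<in> S"
        using that S unfolding bad_def by (intro subspace_diff) auto
      then have "scale (a - b) v \<in> S" by (simp add: scale_left_diff_distrib)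
      then have "scale (inverse (a - b)) (scale (a - b) v) \<in> S" by (rule subspace_scale[OF S])
      then show False using \<open>a \<noteq> b\<close> v that by simp
    qed
    have bad: "finite (bad S) \<and> card (bad S) \<le> 1" if "S \<in> \<S>" for S
    proof (cases "bad S = {}")
      case False
      then obtain c where "c \<in> bad S" by blast
      then have "bad S = {c}" using bad_unique[OF that] by blast
      then show ?thesis by simp
    qed simp
    have fin: "finite (\<Union>S\<in>\<S>. bad S)" using bad insert by auto
    have "card (\<Union>S\<in>\<S>. bad S) \<le> (\<Sum>S\<in>\<S>. card (bad S))"
      using insert by (intro card_UN_le)
    also have "\<dots> \<le> (\<Sum>S\<in>\<S>. 1)" using bad by (intro sum_mono) auto
    finally have "card (\<Union>S\<in>\<S>. bad S) < card (insert S0 \<S>)" using insert by simp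
    then have "(\<Union>S\<in>\<S>. bad S) \<noteq> UNIV" using insert.prems(4) fin by auto
    then obtain c where c: "\<forall>S\<in>\<S>. w + scale c v \<notin> S" unfolding bad_def by auto
    have "w + scale c v \<notin> S0"
    proof
      assume "w + scale c v \<in> S0"
      then have "(w + scale c v) - scale c v \<in> S0"
        using True insert.prems by (intro subspace_diff subspace_scale) auto
      then show False using w by simp
    qed
    moreover have "w + scale c v \<in> V"
      using v w insert by (intro subspace_add subspace_scale) auto
    ultimately show ?thesis using c by auto
  qed
qed

context finite_dimensional_vector_space
begin

text \<open>Grassmann's formula: \<open>dim\<close> of a set is that of its span, so the union
  stands for the sum of the subspaces.\<close>

lemma dim_Un_Int:
  assumes "subspace S" "subspace T"
  shows "dim (S \<union> T) + dim (S \<inter> T) = dim S + dim T"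
proof -
  have "span (S \<union> T) = {x + y |x y. x \<in> S \<and> y \<in> T}"
    using assms by (auto simp: span_Un span_eq_iff[THEN iffD2])
  then show ?thesis using dim_sums_Int[OF assms] by (metis dim_span)
qed

lemma exists_subspace_between:
  assumes "subspace S" "subspace V" "S \<subseteq> V" "dim S \<le> m" "m \<le> dim V"
  shows "\<exists>T. subspace T \<and> S \<subseteq> T \<and> T \<subseteq> V \<and> dim T = m"
  using assms(4,5)
proof (induction m rule: nat_induct_at_least)
  case base
  then show ?case using assms by auto
next
  case (Suc m)
  then obtain T where T: "subspace T" "S \<subseteq> T" "T \<subseteq> V" "dim T = m" by auto
  then have "\<not> V \<subseteq> T" using dim_subset[of V T] Suc by auto
  then obtain v where v: "v \<in> V" "v \<notin> T" by blast
  have "span (insert v T) \<subseteq> V" using v T assms by (intro span_minimal) auto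
  moreover have "T \<subseteq> span (insert v T)" using span_superset by blast
  moreover have "dim (span (insert v T)) = Suc m"
    using T v by (simp add: dim_insert span_eq_iff[THEN iffD2])
  ultimately show ?case using T by (metis subset_trans subspace_span)
qed

lemma dim_UN_le:
  assumes "finite I"
  shows "dim (\<Union>i\<in>I. A i) \<le> (\<Sum>i\<in>I. dim (A i))"
  using assms
proof (induction I rule: finite_induct)
  case (insert i I)
  have "dim (A i \<union> (\<Union>i\<in>I. A i)) \<le> dim (span (A i) \<union> span (\<Union>i\<in>I. A i))"
    by (intro dim_subset Un_mono span_superset)
  also have "\<dots> \<le> dim (span (A i)) + dim (span (\<Union>i\<in>I. A i))"
    using dim_Un_Int[OF subspace_span subspace_span, of "A i" "\<Union>i\<in>I. A i"] by linarith
  finally show ?case using insert by simp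
qed simp

text \<open>Induction on \<open>r\<close> with \<open>n\<close> fixed: a hyperplane of
  \<open>V\<close> is again an ambient space of rank \<open>n + r'\<close>, with
  \<open>r' = r - 1\<close>. The last summand of the bound counts the members absorbed by that
  hyperplane.\<close>

lemma exists_transversal:
  assumes "subspace V" "dim V = n + r" "finite \<H>"
    and "\<And>H. H \<in> \<H> \<Longrightarrow> subspace H \<and> H \<subseteq> V \<and> dim H = r"
    and "card \<H> \<le> (\<Sum>i<r. (n + i) div (i + 1))"
  shows "\<exists>W. subspace W \<and> W \<subseteq> V \<and> dim W = n \<and> (\<forall>H\<in>\<H>. dim (W \<inter> H) > 0)"
  using assms
proof (induction r arbitrary: V \<H>)
  case 0
  \<comment> \<open>The bound is an empty sum, so the family is empty and \<open>V\<close> itself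
    serves.\<close>
  then show ?case by auto
next
  case (Suc r)
  let ?q = "(n + r) div (r + 1)"
  obtain \<A> where \<A>: "\<A> \<subseteq> \<H>" "card \<A> = min ?q (card \<H>)"
    using obtain_subset_with_card_n[of "min ?q (card \<H>)" \<H>] by auto
  have finA: "finite \<A>" using \<A> Suc.prems finite_subset by blast
  have card_rest: "card (\<H> - \<A>) \<le> (\<Sum>i<r. (n + i) div (i + 1))"
    using \<A> finA Suc.prems(5) by (simp add: card_Diff_subset)
  \<comment> \<open>\<open>?q\<close> is the largest number of rank \<open>r + 1\<close> members
    that surely fit into a subspace of rank \<open>n + r\<close>.\<close>
  have "dim (\<Union>H\<in>\<A>. H) \<le> (\<Sum>H\<in>\<A>. dim H)" by (rule dim_UN_le[OF finA])
  also have "\<dots> = card \<A> * (r + 1)" using \<A> Suc.prems(4) by (simp add: subset_iff)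
  also have "\<dots> \<le> ?q * (r + 1)" using \<A> by (intro mult_le_mono) auto
  also have "\<dots> \<le> n + r" by (rule div_times_less_eq_dividend)
  finally have "dim (span (\<Union>\<A>)) \<le> n + r" by simp
  moreover have "span (\<Union>\<A>) \<subseteq> V"
    using \<A> Suc.prems by (intro span_minimal) auto
  ultimately obtain \<Sigma> where \<Sigma>: "subspace \<Sigma>" "span (\<Union>\<A>) \<subseteq> \<Sigma>" "\<Sigma> \<subseteq> V" "dim \<Sigma> = n + r"
    using exists_subspace_between[of "span (\<Union>\<A>)" V "n + r"] Suc.prems by auto
  \<comment> \<open>\<open>H \<inter> \<Sigma>\<close> may have rank \<open>r + 1\<close>; it is cut
    down to rank exactly \<open>r\<close> for the induction hypothesis.\<close>
  have "\<exists>K. subspace K \<and> K \<subseteq> H \<inter> \<Sigma> \<and> dim K = r" if "H \<in> \<H>" for H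
  proof -
    have H: "subspace H" "H \<subseteq> V" "dim H = Suc r" using Suc.prems(4)[OF that] by auto
    have "dim (H \<union> \<Sigma>) \<le> dim V" using H \<Sigma> by (intro dim_subset) auto
    then have "r \<le> dim (H \<inter> \<Sigma>)" using dim_Un_Int[of H \<Sigma>] H \<Sigma> Suc.prems(2) by linarith
    then show ?thesis
      using exists_subspace_between[of "{0}" "H \<inter> \<Sigma>" r] H \<Sigma>
      by (auto simp: subspace_inter subspace_0)
  qed
  then obtain K where K: "\<And>H. H \<in> \<H> \<Longrightarrow> subspace (K H) \<and> K H \<subseteq> H \<inter> \<Sigma> \<and> dim (K H) = r"
    by metis
  have "card (K ` (\<H> - \<A>)) \<le> (\<Sum>i<r. (n + i) div (i + 1))"
    using card_image_le[of "\<H> - \<A>" K] Suc.prems(3) card_rest by auto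
  then obtain W where W: "subspace W" "W \<subseteq> \<Sigma>" "dim W = n"
      "\<forall>L\<in>K ` (\<H> - \<A>). dim (W \<inter> L) > 0"
    using Suc.IH[of \<Sigma> "K ` (\<H> - \<A>)"] \<Sigma> K Suc.prems(3) by blast
  have "dim (W \<inter> H) > 0" if "H \<in> \<H>" for H
  proof (cases "H \<in> \<A>")
    case True
    have H: "subspace H" "dim H = Suc r" using Suc.prems(4)[OF that] by auto
    have "H \<subseteq> \<Sigma>" using True \<Sigma>(2) span_superset by blast
    \<comment> \<open>The ranks of \<open>W\<close> and \<open>H\<close> add up to
      \<open>n + r + 1\<close>, one more than the rank of \<Sigma>, so the two must meet.\<close>
    then have "dim (W \<union> H) \<le> n + r" using W \<Sigma> by (metis dim_subset le_sup_iff)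
    then show ?thesis using dim_Un_Int[of W H] W H by linarith
  next
    case False
    then have "0 < dim (W \<inter> K H)" using W that by auto
    also have "\<dots> \<le> dim (W \<inter> H)" using K[OF that] by (intro dim_subset) auto
    finally show ?thesis .
  qed
  then show ?case using W \<Sigma> by blast
qed

end

lemma generator_set_no_transversal:
  fixes \<H> :: "('a::field ^ 'n) set set"
  assumes "CARD('n) = d + 1" "k < d" "\<And>H. H \<in> \<H> \<Longrightarrow> proj_subspace k H"
    and "generator_set k \<H>" "finite \<H>"
    and "infinite (UNIV :: 'a set) \<or> card \<H> \<le> CARD('a)"
    and "vec.subspace W" "vec.dim W = d - k"
  shows "\<exists>H\<in>\<H>. vec.dim (W \<inter> H) = 0"
proof (rule ccontr)
  assume neg: "\<not> ?thesis"
  have dimU: "vec.dim (UNIV :: ('a ^ 'n) set) = d + 1"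
    using assms(1) by (simp add: card_cart_basis)
  let ?S = "(\<lambda>H. vec.span (H \<union> W)) ` \<H>"
  \<comment> \<open>The ranks \<open>d - k\<close> and \<open>k + 1\<close> add up to exactly
    \<open>d + 1\<close>, so any nonzero intersection keeps \<open>H + W\<close> from filling the
    space.\<close>
  have proper: "\<not> UNIV \<subseteq> vec.span (H \<union> W)" if "H \<in> \<H>" for H
  proof
    assume "UNIV \<subseteq> vec.span (H \<union> W)"
    then have "vec.dim (H \<union> W) = d + 1" using dimU by (metis vec.dim_span top.extremum_uniqueI)
    moreover have "vec.dim (H \<inter> W) > 0" using neg that by (metis Int_commute gr0I)
    moreover have "vec.subspace H" "vec.dim H = k + 1"
      using assms(3)[OF that] by (auto simp: proj_subspace_def)
    ultimately show False using vec.dim_Un_Int[of H W] assms by linarith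
  qed
  have "infinite (UNIV :: 'a set) \<or> card ?S \<le> CARD('a)"
    using card_image_le[OF assms(5)] assms(6) order_trans by blast
  then have "\<exists>v\<in>UNIV. \<forall>S\<in>?S. v \<notin> S"
    using proper assms(5)
    by (intro vec.subspace_not_covered) (blast intro: vec.subspace_UNIV vec.subspace_span)+
  then obtain v0 where v0: "\<forall>H\<in>\<H>. v0 \<notin> vec.span (H \<union> W)" by auto
  have "W \<noteq> UNIV" using assms(8) dimU by auto
  \<comment> \<open>For empty \<open>\<H>\<close> the choice of \<open>v0\<close> is unrestricted, so it may lie in \<open>W\<close>.\<close>
  then obtain v where vW: "v \<notin> W" and v: "\<forall>H\<in>\<H>. v \<notin> vec.span (H \<union> W)"
  proof (cases "\<H> = {}")
    case False
    then have "v0 \<notin> W" using v0 vec.span_base by blast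
    then show ?thesis using that v0 by blast
  qed blast
  define U where "U = vec.span (insert v W)"
  have W: "vec.span W = W" using assms by (simp add: vec.span_eq_iff)
  \<comment> \<open>Adding \<open>v\<close> raises the rank to \<open>d - k + 1\<close>, that is,
    projective dimension \<open>d - k\<close>.\<close>
  have "proj_cosubspace k U"
    unfolding proj_cosubspace_def proj_subspace_def U_def
    using assms(1,2,8) vW by (intro exI[of _ "d - k"]) (simp add: vec.dim_insert W)
  then have "vec.span (\<Union> {P. proj_point P \<and> P \<subseteq> U \<and> (\<exists>H\<in>\<H>. P \<subseteq> H)}) = U" (is "vec.span ?X = U")
    using assms(4) unfolding generator_set_def proj_span_def by blast
  moreover have "vec.span ?X \<subseteq> W"
  proof (rule vec.span_minimal)
    show "?X \<subseteq> W"
    proof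
      fix p assume "p \<in> ?X"
      then obtain H where H: "H \<in> \<H>" "p \<in> H" and "p \<in> U" by auto
      then obtain c where c: "p - c *s v \<in> W"
        unfolding U_def vec.span_breakdown_eq W by auto
      \<comment> \<open>With \<open>p\<close> in \<open>H\<close> and \<open>p - c v\<close> in
        \<open>W\<close>, the multiple \<open>c v\<close> lies in \<open>H + W\<close>; since
        \<open>v\<close> does not, \<open>c = 0\<close>.\<close>
      have "p - (p - c *s v) \<in> vec.span (H \<union> W)"
        using H c by (intro vec.span_diff vec.span_base) auto
      then have "c *s v \<in> vec.span (H \<union> W)" by simp
      then have "inverse c *s (c *s v) \<in> vec.span (H \<union> W)"
        by (rule vec.span_scale)
      then have "c = 0" using v H by (metis vec.scale_scale left_inverse vec.scale_one)
      then show "p \<in> W" using c by simp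
    qed
  qed (rule assms)
  moreover have "v \<in> U" unfolding U_def by (intro vec.span_base) simp
  ultimately show False using vW by auto
qed

theorem mainTheorem9:
  fixes d k :: nat
    and \<H> :: "('a::field ^ 'n) set set"
  assumes "CARD('n) = d + 1"
    and "k < d"
    and "\<And>H. H \<in> \<H> \<Longrightarrow> proj_subspace k H"
    and "generator_set k \<H>"
  shows "infinite \<H> \<or>
    (let s = (\<Sum>i=0..k. (d - k + i) div (i + 1))
     in (if finite (UNIV :: 'a set) then min (CARD('a)) s else s) + 1 \<le> card \<H>)"
proof (rule ccontr)
  assume neg: "\<not> ?thesis"
  then have fin: "finite \<H>" by simp
  have "card \<H> \<le> (\<Sum>i=0..k. (d - k + i) div (i + 1))"
    and small: "infinite (UNIV :: 'a set) \<or> card \<H> \<le> CARD('a)"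
    using neg by (auto simp: Let_def split: if_splits)
  then have "card \<H> \<le> (\<Sum>i<k + 1. (d - k + i) div (i + 1))"
    by (simp add: atLeast0AtMost lessThan_Suc_atMost)
  moreover have "vec.dim (UNIV :: ('a ^ 'n) set) = (d - k) + (k + 1)"
    using assms(1,2) by (simp add: card_cart_basis)
  ultimately obtain W :: "('a ^ 'n) set" where
    "vec.subspace W" "vec.dim W = d - k" "\<forall>H\<in>\<H>. vec.dim (W \<inter> H) > 0"
    using vec.exists_transversal[of UNIV "d - k" "k + 1" \<H>] fin assms(3)
    by (auto simp: proj_subspace_def)
  then show False
    using generator_set_no_transversal[OF assms fin small, of W] by (metis less_irrefl)
qed

end
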